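(* Let $Z=\mathrm{diag}(z_1,\dots,z_m)\in\mathbb{C}^{m\times m}$ with pairwise distinct $z_i\in\mathbb{C}$, let $v,w\in\mathbb{C}^m$ have only nonzero entries with $\langle v,w\rangle=w^Hv\neq0$, and let $\Xi=\{\xi_i\}_{i=1}^{m-1}$, $\Psi=\{\psi_i\}_{i=1}^{m-1}$ be poles in $\overline{\mathbb{C}}=\mathbb{C}\cup\{\infty\}$ with $\xi_i\notin\{z_j\}_j$ and $\psi_i\notin\{\bar z_j\}_j$. Let $V,W\in\mathbb{C}^{m\times m}$ be the bases and $T,S\in\mathbb{C}^{m\times m}$ the matrices of recurrence coefficients obtained by applying the rational Lanczos iteration for $\mathcal{K}_m(Z,v;\Xi)$ and $\mathcal{K}_m(Z^H,w;\Psi)$. If the iteration does not break down, then these matrices solve the tridiagonal pencil inverse eigenvalue problem, that is: $T$ and $S$ are tridiagonal, $$\frac{t_{i+1,i}}{s_{i+1,i}}=\xi_i\ (i=1,\dots,m-1),\qquad \frac{t_{i,i+1}}{s_{i,i+1}}=\bar\psi_{i-1}\ (i=2,\dots,m-1),$$ $$W^HV=I,\qquad W^HZVS=T,$$ and $Ve_1=\frac{v}{\nu}$, $We_1=\frac{w}{\eta}$ for scalars $\nu,\eta\in\mathbb{C}$ with $w^Hv=\nu\bar\eta$.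
   Context: Notation: $e_1$ is the first canonical unit vector, $\langle x,y\rangle=y^Hx$. A ratio $t/s$ equals $\xi=\nu/\mu\in\overline{\mathbb{C}}$ means $(t,s)\ne(0,0)$ and $\mu t=\nu s$ ($\mu=0$ for $\xi=\infty$); $\overline{\infty}=\infty$. Rational Krylov subspace: for $A\in\mathbb{C}^{m\times m}$, $v\in\mathbb{C}^m$ and poles $\xi_i=\nu_i/\mu_i$, $\mathcal{K}_n(A,v;\Xi)=\mathrm{span}\{v,(\rho_iA-\eta_iI)(\mu_iA-\nu_iI)^{-1}t_i: 1\le i\le n-1\}$, where $\rho_i\nu_i\ne\eta_i\mu_i$ and the continuation vectors $t_i\in\mathcal{K}_i(A,v;\Xi)$ are chosen such that $\dim\mathcal{K}_n(A,v;\Xi)=n$ for all $n\le m$. Rational Lanczos iteration for $\mathcal{K}_m(A,v;\Xi)$ and $\mathcal{K}_m(A^H,w;\Psi)$: when it does not break down (i.e. it runs to completion and the resulting bases span $\mathbb{C}^m$), it produces a pair of biorthonormal nested bases $V=[v_1\cdots v_m]$, $W=[w_1\cdots w_m]$, i.e. $w_i^Hv_j=\delta_{i,j}$, $\mathrm{span}\{v_1,\dots,v_k\}=\mathcal{K}_k(A,v;\Xi)$ and $\mathrm{span}\{w_1,\dots,w_k\}=\mathcal{K}_k(A^H,w;\Psi)$ for $k=1,\dots,m$, together with tridiagonal $m\times m$ matrices of recurrence coefficients $T=(t_{i,j})$, $S=(s_{i,j})$ satisfying the recurrence $AVS=VT$ and having the poles as ratios of off-diagonal entries: $t_{i+1,i}/s_{i+1,i}=\xi_i$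 for $i=1,\dots,m-1$ and $t_{i,i+1}/s_{i,i+1}=\bar\psi_{i-1}$ for $i=2,\dots,m-1$ (the ratio $t_{1,2}/s_{1,2}$ is not a pole). *)

theory Defs
  imports
    Complex_Main
    "Jordan_Normal_Form.Schur_Decomposition"
    "Jordan_Normal_Form.DL_Rank"
begin

text \<open>The extended complex plane. A point is represented as a ratio \<open>num / den\<close>, with
  \<open>c = c / 1\<close> and \<open>\<infinity> = 1 / 0\<close>; nothing below depends on the scaling of this representative.\<close>

datatype ext_complex = Pt complex | Infty

fun num :: "ext_complex \<Rightarrow> complex" where
  "num (Pt c) = c"
| "num Infty = 1"

fun den :: "ext_complex \<Rightarrow> complex" where
  "den (Pt c) = 1"
| "den Infty = 0"

fun ext_cnj :: "ext_complex \<Rightarrow> ext_complex" where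
  "ext_cnj (Pt c) = Pt (cnj c)"
| "ext_cnj Infty = Infty"

definition ratio_eq :: "complex \<Rightarrow> complex \<Rightarrow> ext_complex \<Rightarrow> bool" where
  "ratio_eq t s \<xi> \<longleftrightarrow> (t, s) \<noteq> (0, 0) \<and> den \<xi> * t = num \<xi> * s"

definition tridiagonal :: "'a::zero mat \<Rightarrow> bool" where
  "tridiagonal A \<longleftrightarrow>
     (\<forall>i<dim_row A. \<forall>j<dim_col A. i + 1 < j \<or> j + 1 < i \<longrightarrow> A $$ (i, j) = 0)"

abbreviation cspan :: "nat \<Rightarrow> complex vec set \<Rightarrow> complex vec set" where
  "cspan m \<equiv> LinearCombinations.module.span class_ring (module_vec TYPE(complex) m)"

definition subspace_dim :: "nat \<Rightarrow> complex vec set \<Rightarrow> nat" where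
  "subspace_dim m U = vectorspace.dim class_ring (module_vec TYPE(complex) m\<lparr>carrier := U\<rparr>)"

text \<open>\<open>rational_krylov m A v \<xi> K\<close>: the sets \<open>K 1, \<dots>, K m\<close> are the rational Krylov subspaces of
  \<open>A\<close>, \<open>v\<close> with poles \<open>\<xi> 1, \<dots>, \<xi> (m - 1)\<close>, for some admissible choice of the parameters
  \<open>\<rho>\<close>, \<open>\<eta>\<close> and of the continuation vectors \<open>t\<close>. Subspaces and poles are indexed from 1.
  The function \<open>mat_inverse\<close> is option-valued; it is \<open>Some\<close> for every \<open>\<xi> i\<close> that is not an
  eigenvalue of \<open>A\<close>.\<close>

definition rational_krylov ::
    "nat \<Rightarrow> complex mat \<Rightarrow> complex vec \<Rightarrow> (nat \<Rightarrow> ext_complex) \<Rightarrow> (nat \<Rightarrow> complex vec set) \<Rightarrow> bool" where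
  "rational_krylov m A v \<xi> K \<longleftrightarrow> (\<exists>\<rho> \<eta> t.
     (\<forall>i\<in>{1..<m}. \<rho> i * num (\<xi> i) \<noteq> \<eta> i * den (\<xi> i) \<and> t i \<in> K i) \<and>
     (\<forall>n\<in>{1..m}.
        K n = cspan m (insert v
          {(\<rho> i \<cdot>\<^sub>m A - \<eta> i \<cdot>\<^sub>m 1\<^sub>m m) *\<^sub>v
             (the (mat_inverse (den (\<xi> i) \<cdot>\<^sub>m A - num (\<xi> i) \<cdot>\<^sub>m 1\<^sub>m m)) *\<^sub>v t i) | i. i \<in> {1..<n}}) \<and>
        subspace_dim m (K n) = n))"

text \<open>\<open>rational_lanczos m A v w \<xi> \<psi> V W T S\<close>: the rational Lanczos iteration for
  \<open>K\<^sub>m(A, v; \<xi>)\<close> and \<open>K\<^sub>m(A\<^sup>H, w; \<psi>)\<close> has run to completion without breakdown and has produced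
  the bases \<open>V\<close>, \<open>W\<close> and the recurrence coefficients \<open>T\<close>, \<open>S\<close>. Matrix indices start at 0, so
  the 1-based entry \<open>t\<^sub>i\<^sub>+\<^sub>1\<^sub>,\<^sub>i\<close> is \<open>T $$ (i, i - 1)\<close>. The superdiagonal ratio in position
  \<open>(1, 2)\<close> is not prescribed. That the columns of \<open>V\<close> and \<open>W\<close> span the whole space is implied by
  biorthonormality.\<close>

definition rational_lanczos ::
    "nat \<Rightarrow> complex mat \<Rightarrow> complex vec \<Rightarrow> complex vec \<Rightarrow> (nat \<Rightarrow> ext_complex) \<Rightarrow> (nat \<Rightarrow> ext_complex) \<Rightarrow>
     complex mat \<Rightarrow> complex mat \<Rightarrow> complex mat \<Rightarrow> complex mat \<Rightarrow> bool" where
  "rational_lanczos m A v w \<xi> \<psi> V W T S \<longleftrightarrow>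
     V \<in> carrier_mat m m \<and> W \<in> carrier_mat m m \<and> T \<in> carrier_mat m m \<and> S \<in> carrier_mat m m \<and>
     (\<exists>K L. rational_krylov m A v \<xi> K \<and> rational_krylov m (mat_adjoint A) w \<psi> L \<and>
        (\<forall>k\<in>{1..m}. cspan m {col V j | j. j < k} = K k \<and> cspan m {col W j | j. j < k} = L k)) \<and>
     (\<forall>i<m. \<forall>j<m. col V j \<bullet>c col W i = (if i = j then 1 else 0)) \<and>
     tridiagonal T \<and> tridiagonal S \<and>
     A * V * S = V * T \<and>
     (\<forall>i\<in>{1..<m}. ratio_eq (T $$ (i, i - 1)) (S $$ (i, i - 1)) (\<xi> i)) \<and>
     (\<forall>i\<in>{2..<m}. ratio_eq (T $$ (i - 1, i)) (S $$ (i - 1, i)) (ext_cnj (\<psi> (i - 1))))"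

end

theory Submission
  imports Defs
begin

text \<open>A completed iteration already supplies the band structure, the pole ratios and the
  recurrence \<open>Z * V * S = V * T\<close>, so only the matrix identities and the first columns
  need an argument. Biorthonormality, read entrywise, says that \<open>mat_adjoint W\<close> is a
  left inverse of \<open>V\<close> (\<open>mat_adjoint_mult_eq_one\<close>); multiplying the
  recurrence by it from the left isolates \<open>T\<close>. Since the first Krylov space is the line
  through the starting vector, nestedness at level one makes \<open>v\<close> and \<open>w\<close>
  multiples of the first basis vectors (\<open>starting_vector_multiple\<close>), and their inner
  product is then the product of the two scalars, the second conjugated.\<close>

lemma cspan_singletonD:
  assumes u: "u \<in> carrier_vec m" and x: "x \<in> cspan m {u}"
  obtains c where "x = c \<cdot>\<^sub>v u"
proof -
  interpret vec_space "TYPE(complex)" m .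
  obtain a where "x = lincomb a {u}"
    using x u finite_in_span[of "{u}" x] by auto
  moreover have "lincomb a {u} = a u \<cdot>\<^sub>v u"
    using u by (simp add: lincomb_def)
  ultimately show thesis
    using that by blast
qed

lemma in_cspan_singleton:
  assumes "u \<in> carrier_vec m"
  shows "u \<in> cspan m {u}"
proof -
  interpret vec_space "TYPE(complex)" m .
  show ?thesis
    using assms by (intro span_mem) auto
qed

lemma mat_adjoint_mult_eq_one:
  assumes V: "V \<in> carrier_mat m m" and W: "W \<in> carrier_mat m m"
    and biorth: "\<And>i j. i < m \<Longrightarrow> j < m \<Longrightarrow> col V j \<bullet>c col W i = (if i = j then 1 else 0)"
  shows "mat_adjoint W * V = 1\<^sub>m m"
proof (rule eq_matI)
  fix i j assume ij: "i < dim_row (1\<^sub>m m)" "j < dim_col (1\<^sub>m m)"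
  then have "(mat_adjoint W * V) $$ (i, j) = conjugate (col W i) \<bullet> col V j"
    using V W by (simp add: mat_adjoint_def)
  also have "\<dots> = col V j \<bullet>c col W i"
    using V W ij by (intro comm_scalar_prod[of _ m]) auto
  \<comment> \<open>\<open>\<bullet>c\<close> conjugates its second argument, whereas a row of the
    adjoint puts the conjugate first; hence the swap just made.\<close>
  finally show "(mat_adjoint W * V) $$ (i, j) = 1\<^sub>m m $$ (i, j)"
    using biorth ij by simp
qed (use V W in \<open>auto simp: mat_adjoint_def\<close>)

text \<open>At level one no pole contributes a generator, because the index range
  \<open>{1..<1}\<close> is empty, so \<open>K 1\<close> is spanned by \<open>v\<close> alone. It is
  stated for a general matrix so that it serves both \<open>Z\<close> with \<open>v\<close> and the
  adjoint with \<open>w\<close>.\<close>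

lemma starting_vector_multiple:
  assumes K: "rational_krylov m A v \<xi> K"
    and "cspan m {col V j | j. j < (1::nat)} = K 1"
    and "V \<in> carrier_mat m m" and "v \<in> carrier_vec m" and "0 < m"
  obtains c where "v = c \<cdot>\<^sub>v col V 0"
proof -
  have "K 1 = cspan m {v}"
    using K \<open>0 < m\<close> unfolding rational_krylov_def by fastforce
  moreover have "{col V j | j. j < (1::nat)} = {col V 0}"
    by auto
  ultimately have "v \<in> cspan m {col V 0}"
    using assms in_cspan_singleton[of v m] by simp
  then show thesis
    using cspan_singletonD[of "col V 0" m v] assms that by auto
qed

theorem theorem3p2:
  fixes m :: nat and z :: "nat \<Rightarrow> complex" and v w :: "complex vec"
    and \<xi> \<psi> :: "nat \<Rightarrow> ext_complex" and Z V W T S :: "complex mat"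
  defines "Z \<equiv> mat_diag m z"
  assumes "inj_on z {..<m}"
    and "v \<in> carrier_vec m" and "w \<in> carrier_vec m"
    and "\<forall>i<m. v $ i \<noteq> 0" and "\<forall>i<m. w $ i \<noteq> 0"
    and "v \<bullet>c w \<noteq> 0"
    and "\<forall>i\<in>{1..<m}. \<forall>j<m. \<xi> i \<noteq> Pt (z j)"
    and "\<forall>i\<in>{1..<m}. \<forall>j<m. \<psi> i \<noteq> Pt (cnj (z j))"
    and "rational_lanczos m Z v w \<xi> \<psi> V W T S"
  shows "tridiagonal T \<and> tridiagonal S \<and>
    (\<forall>i\<in>{1..<m}. ratio_eq (T $$ (i, i - 1)) (S $$ (i, i - 1)) (\<xi> i)) \<and>
    (\<forall>i\<in>{2..<m}. ratio_eq (T $$ (i - 1, i)) (S $$ (i - 1, i)) (ext_cnj (\<psi> (i - 1)))) \<and>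
    mat_adjoint W * V = 1\<^sub>m m \<and>
    mat_adjoint W * Z * V * S = T \<and>
    (\<exists>\<nu> \<eta> :: complex.
       V *\<^sub>v unit_vec m 0 = (1 / \<nu>) \<cdot>\<^sub>v v \<and>
       W *\<^sub>v unit_vec m 0 = (1 / \<eta>) \<cdot>\<^sub>v w \<and>
       v \<bullet>c w = \<nu> * cnj \<eta>)"
proof -
  note v = \<open>v \<in> carrier_vec m\<close> and w = \<open>w \<in> carrier_vec m\<close> and vw = \<open>v \<bullet>c w \<noteq> 0\<close>
  note lanczos = \<open>rational_lanczos m Z v w \<xi> \<psi> V W T S\<close>[unfolded rational_lanczos_def]
  have V: "V \<in> carrier_mat m m" and W: "W \<in> carrier_mat m m"
    and T: "T \<in> carrier_mat m m" and S: "S \<in> carrier_mat m m"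
    and rec: "Z * V * S = V * T"
    and biorth: "\<And>i j. i < m \<Longrightarrow> j < m \<Longrightarrow> col V j \<bullet>c col W i = (if i = j then 1 else 0)"
    using lanczos by blast+
  have Z: "Z \<in> carrier_mat m m" and W': "mat_adjoint W \<in> carrier_mat m m"
    using W by (auto simp: Z_def mat_adjoint_def)
  have WV: "mat_adjoint W * V = 1\<^sub>m m"
    using mat_adjoint_mult_eq_one[OF V W] biorth by blast
  have "mat_adjoint W * Z * V * S = mat_adjoint W * (Z * V * S)"
    using W' Z V S by (simp add: assoc_mult_mat[of _ m m _ m _ m])
  also have "\<dots> = mat_adjoint W * V * T"
    using W' V T by (simp add: rec assoc_mult_mat[of _ m m _ m _ m])
  finally have pencil: "mat_adjoint W * Z * V * S = T"
    using WV T by simp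
  \<comment> \<open>In dimension 0 the inner product would be an empty sum, contradicting
    \<open>vw\<close>.\<close>
  have m: "0 < m"
    using vw v w by (cases m) (auto simp: scalar_prod_def)
  obtain K L where K: "rational_krylov m Z v \<xi> K" and L: "rational_krylov m (mat_adjoint Z) w \<psi> L"
    and spans: "\<And>k. k \<in> {1..m} \<Longrightarrow>
      cspan m {col V j | j. j < k} = K k \<and> cspan m {col W j | j. j < k} = L k"
    using lanczos by blast
  have "1 \<in> {1..m}"
    using m by simp
  \<comment> \<open>The scalars multiply the basis vectors, so nothing is divided before they are
    known to be nonzero.\<close>
  from spans[OF this] obtain \<nu> \<eta> where \<nu>: "v = \<nu> \<cdot>\<^sub>v col V 0" and \<eta>: "w = \<eta> \<cdot>\<^sub>v col W 0"
    using starting_vector_multiple[OF K _ V v m] starting_vector_multiple[OF L _ W w m] by metis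
  have cV: "col V 0 \<in> carrier_vec m" and cW: "col W 0 \<in> carrier_vec m"
    using V W m by auto
  \<comment> \<open>Sesquilinearity pulls out both scalars; the remaining inner product of the first
    columns is 1.\<close>
  have prod: "v \<bullet>c w = \<nu> * cnj \<eta>"
    using cV cW biorth[of 0 0] m by (simp add: \<nu> \<eta> conjugate_smult_vec)
  then have "\<nu> \<noteq> 0" "\<eta> \<noteq> 0"
    using vw by auto
  \<comment> \<open>Applying a matrix to the first unit vector gives its column 0, and the nonzero
    scalars can now be inverted.\<close>
  then have "V *\<^sub>v unit_vec m 0 = (1 / \<nu>) \<cdot>\<^sub>v v" "W *\<^sub>v unit_vec m 0 = (1 / \<eta>) \<cdot>\<^sub>v w"
    using V W m by (auto simp: \<nu> \<eta> smult_smult_assoc intro!: eq_vecI)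
  with lanczos WV pencil prod show ?thesis
    by blast
qed

end
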